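(* Let $X\in C^4(B,\mathbb R^4)$ be a conformally parametrized immersion and let $\{N_1,N_2\}$ be an orthonormal normal section of $X$ which is critical for the total torsion $\mathcal T_X$. Then the torsion coefficients satisfy $$\operatorname{div}(T_{1,1}^2,T_{1,2}^2)=0\ \text{ in } B,\qquad (T_{1,1}^2,T_{1,2}^2)\cdot\nu=0\ \text{ on }\partial B,$$ where $\nu$ is the outer unit normal to $\partial B$.
   Context: $B=\{(u,v)\in\mathbb R^2: u^2+v^2\le 1\}$ is the closed unit disc and $\partial B$ the unit circle. A conformally parametrized immersion is a map $X\in C^4(B,\mathbb R^4)$ with $|X_u|^2=|X_v|^2=:W>0$ and $X_u\cdot X_v=0$ in $B$. An orthonormal normal section of $X$ is a pair $N_1,N_2\in C^3(B,\mathbb R^4)$ with $X_u\cdot N_\sigma=X_v\cdot N_\sigma=0$, $|N_1|=|N_2|=1$, $N_1\cdot N_2=0$ in $B$. Torsion coefficients: $T_{1,1}^2:=N_{1,u}\cdot N_2$, $T_{1,2}^2:=N_{1,v}\cdot N_2$ (subscripts $u,v$ denote partial derivatives), and $\operatorname{div}(a,b)=a_u+b_v$. Total torsion: $\mathcal T_X(N_1,N_2):=2\iint_B\{(T_{1,1}^2)^2+(T_{1,2}^2)^2\}\,du\,dv$. The section $\{N_1,N_2\}$ is critical for $\mathcal T_X$ if for every $\varphi\in C^3(B,\mathbb R)$ the function $t\mapsto\mathcal T_X(\cos(t\varphi)N_1+\sin(t\varphi)N_2,\,-\sin(t\varphi)N_1+\cos(t\varphi)N_2)$ has vanishing derivative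 at $t=0$. *)

theory Defs
  imports "HOL-Analysis.Analysis"
begin

definition disc :: "(real \<times> real) set" where
  "disc = {(u, v). u\<^sup>2 + v\<^sup>2 \<le> 1}"

definition circle :: "(real \<times> real) set" where
  "circle = {(u, v). u\<^sup>2 + v\<^sup>2 = 1}"

text \<open>Partial derivatives on the closed disc are taken from the Frechet derivative within the disc.
  As the disc is convex with nonempty interior, this derivative is unique at every point where it
  exists, boundary points included (where plain difference quotients along a coordinate axis may
  leave the disc).\<close>

definition du :: "(real \<times> real \<Rightarrow> 'a::real_normed_vector) \<Rightarrow> real \<times> real \<Rightarrow> 'a" where
  "du f p = frechet_derivative f (at p within disc) (1, 0)"

definition dv :: "(real \<times> real \<Rightarrow> 'a::real_normed_vector) \<Rightarrow> real \<times> real \<Rightarrow> 'a" where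
  "dv f p = frechet_derivative f (at p within disc) (0, 1)"

text \<open>\<open>C_disc k f\<close>: \<open>f\<close> is of class \<open>C\<^sup>k\<close> on the closed disc, up to the boundary.
  By convexity this is the same as having partial derivatives up to order \<open>k\<close> in the open disc
  which extend continuously to the closed disc.\<close>

primrec C_disc :: "nat \<Rightarrow> (real \<times> real \<Rightarrow> 'a::real_normed_vector) \<Rightarrow> bool" where
  "C_disc 0 f \<longleftrightarrow> continuous_on disc f"
| "C_disc (Suc k) f \<longleftrightarrow> f differentiable_on disc \<and> C_disc k (du f) \<and> C_disc k (dv f)"

definition conformal_immersion :: "(real \<times> real \<Rightarrow> real^4) \<Rightarrow> bool" where
  "conformal_immersion X \<longleftrightarrow> C_disc 4 X \<and>
     (\<forall>p\<in>disc. (norm (du X p))\<^sup>2 = (norm (dv X p))\<^sup>2 \<and> (norm (du X p))\<^sup>2 > 0 \<and>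
                du X p \<bullet> dv X p = 0)"

definition orthonormal_normal_section ::
  "(real \<times> real \<Rightarrow> real^4) \<Rightarrow> (real \<times> real \<Rightarrow> real^4) \<Rightarrow> (real \<times> real \<Rightarrow> real^4) \<Rightarrow> bool" where
  "orthonormal_normal_section X N1 N2 \<longleftrightarrow> C_disc 3 N1 \<and> C_disc 3 N2 \<and>
     (\<forall>p\<in>disc. du X p \<bullet> N1 p = 0 \<and> dv X p \<bullet> N1 p = 0 \<and>
                du X p \<bullet> N2 p = 0 \<and> dv X p \<bullet> N2 p = 0 \<and>
                norm (N1 p) = 1 \<and> norm (N2 p) = 1 \<and> N1 p \<bullet> N2 p = 0)"

definition torsion_u ::
  "(real \<times> real \<Rightarrow> real^4) \<Rightarrow> (real \<times> real \<Rightarrow> real^4) \<Rightarrow> real \<times> real \<Rightarrow> real" where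
  "torsion_u N1 N2 p = du N1 p \<bullet> N2 p"

definition torsion_v ::
  "(real \<times> real \<Rightarrow> real^4) \<Rightarrow> (real \<times> real \<Rightarrow> real^4) \<Rightarrow> real \<times> real \<Rightarrow> real" where
  "torsion_v N1 N2 p = dv N1 p \<bullet> N2 p"

definition divergence ::
  "(real \<times> real \<Rightarrow> real) \<Rightarrow> (real \<times> real \<Rightarrow> real) \<Rightarrow> real \<times> real \<Rightarrow> real" where
  "divergence a b p = du a p + dv b p"

text \<open>The immersion enters the total torsion only through the condition that the section be
  normal to it, so it is not an argument here.\<close>

definition total_torsion :: "(real \<times> real \<Rightarrow> real^4) \<Rightarrow> (real \<times> real \<Rightarrow> real^4) \<Rightarrow> real" where
  "total_torsion N1 N2 =
     2 * (LINT p:disc|lborel. (torsion_u N1 N2 p)\<^sup>2 + (torsion_v N1 N2 p)\<^sup>2)"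

definition critical_for_total_torsion ::
  "(real \<times> real \<Rightarrow> real^4) \<Rightarrow> (real \<times> real \<Rightarrow> real^4) \<Rightarrow> bool" where
  "critical_for_total_torsion N1 N2 \<longleftrightarrow>
     (\<forall>\<phi> :: real \<times> real \<Rightarrow> real. C_disc 3 \<phi> \<longrightarrow>
        ((\<lambda>t. total_torsion
                (\<lambda>p. cos (t * \<phi> p) *\<^sub>R N1 p + sin (t * \<phi> p) *\<^sub>R N2 p)
                (\<lambda>p. - sin (t * \<phi> p) *\<^sub>R N1 p + cos (t * \<phi> p) *\<^sub>R N2 p))
          has_real_derivative 0) (at 0))"

text \<open>The outer unit normal to the unit circle at one of its points is that point itself.\<close>

definition outer_unit_normal :: "real \<times> real \<Rightarrow> real \<times> real" where
  "outer_unit_normal p = p"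

end

theory Submission imports Defs begin

text \<open>Rotating the section by the angle \<open>t\<phi>\<close> adds \<open>t \<nabla>\<phi>\<close> to the torsion field \<open>Z\<close>, so the total
  torsion is a quadratic polynomial in \<open>t\<close> and criticality says \<open>\<integral> Z \<bullet> \<nabla>\<phi> = 0\<close> for all \<open>\<phi>\<close>.
  The pointwise equations follow from two test functions, without integration by parts.
  If \<open>Z \<bullet> p > 0\<close> at a boundary point \<open>p\<close>, take \<open>\<phi>\<close> to be the fourth power of the positive part of
  \<open>q \<bullet> p - (1 - \<delta>)\<close>: its gradient is a nonnegative multiple of \<open>p\<close>, supported in a cap on which
  \<open>Z \<bullet> p > 0\<close>. If \<open>div Z > 0\<close> at an interior point \<open>p\<close>, take the fourth power of the positive part
  of \<open>r\<^sup>2 - |q - p|\<^sup>2\<close> and average the integrand over the four quarter turns about \<open>p\<close>: the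
  average of \<open>Z(p + h) \<bullet> h\<close> is \<open>|h|\<^sup>2 div Z(p) / 2 + o(|h|\<^sup>2)\<close>, which is positive for small \<open>h\<close>.\<close>

section \<open>Derivatives on the closed disc\<close>

lemma disc_eq_cball: "disc = cball 0 1"
  by (auto simp: disc_def norm_Pair)

text \<open>At boundary points a coordinate direction may leave the disc, so the derivatives are compared
  along the segments from \<open>p\<close> to all points \<open>q\<close> of the disc.\<close>

lemma has_derivative_within_disc_unique:
  assumes D1: "(f has_derivative D1) (at p within disc)"
    and D2: "(f has_derivative D2) (at p within disc)" and p: "p \<in> disc"
  shows "D1 = D2"
proof -
  interpret D1: bounded_linear D1 using D1 by (rule has_derivative_bounded_linear)
  interpret D2: bounded_linear D2 using D2 by (rule has_derivative_bounded_linear)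
  have dir: "D1 q - D1 p = D2 q - D2 p" if q: "q \<in> disc" for q
  proof -
    define g where "g t = p + t *\<^sub>R (q - p)" for t :: real
    have sub: "g ` {0..1} \<subseteq> disc"
    proof
      fix y assume "y \<in> g ` {0..1}"
      then obtain t where t: "0 \<le> t" "t \<le> 1" "y = g t" by auto
      have "y = (1 - t) *\<^sub>R p + t *\<^sub>R q" using t by (simp add: g_def algebra_simps)
      moreover have "convex disc" by (simp add: disc_eq_cball)
      ultimately show "y \<in> disc" using t p q by (simp add: convex_alt)
    qed
    have g: "(g has_derivative (\<lambda>t. t *\<^sub>R (q - p))) (at 0 within {0..1})"
      unfolding g_def by (auto intro!: derivative_eq_intros)
    have g0: "g 0 = p" by (simp add: g_def)
    have "((f \<circ> g) has_vector_derivative D (q - p)) (at 0 within {0..1})"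
      if D: "(f has_derivative D) (at p within disc)" for D
    proof -
      interpret D: bounded_linear D using D by (rule has_derivative_bounded_linear)
      have "(f has_derivative D) (at (g 0) within g ` {0..1})"
        using D sub g0 by (auto intro: has_derivative_subset)
      from diff_chain_within[OF g this] show ?thesis
        by (simp add: has_vector_derivative_def o_def D.scaleR)
    qed
    from this[OF D1] this[OF D2] have "D1 (q - p) = D2 (q - p)"
      by (rule vector_derivative_unique_within[rotated]) (simp add: trivial_limit_within islimpt_Icc)
    then show ?thesis by (simp add: D1.diff D2.diff)
  qed
  \<comment> \<open>The origin lies in the disc, so \<open>dir[of 0]\<close> gives
    \<open>D1 p = D2 p\<close> and the segment identity reduces to equality at \<open>q\<close>.
    Both unit coordinate vectors are such points.\<close>
  have "D1 q = D2 q" if "q \<in> disc" for q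
    using dir[OF that] dir[of 0] by (simp add: disc_eq_cball D1.zero D2.zero)
  then have "D1 (1, 0) = D2 (1, 0)" "D1 (0, 1) = D2 (0, 1)"
    by (simp_all add: disc_def)
  moreover have "h = fst h *\<^sub>R (1, 0) + snd h *\<^sub>R (0, 1)" for h :: "real \<times> real"
    by (simp add: prod_eq_iff)
  ultimately show ?thesis
    by (metis (no_types) D1.add D1.scaleR D2.add D2.scaleR ext)
qed

text \<open>\<open>frechet_derivative\<close> is a Hilbert choice; uniqueness within the disc is
  what allows \<open>du\<close> and \<open>dv\<close> to be read off from any derivative, at
  boundary points too.\<close>

lemma du_dv_eqI:
  assumes "(f has_derivative D) (at p within disc)" "p \<in> disc"
  shows "du f p = D (1, 0)" "dv f p = D (0, 1)"
proof -
  have "(f has_derivative frechet_derivative f (at p within disc)) (at p within disc)"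
    using assms(1) by (meson differentiableI frechet_derivative_works)
  then have "frechet_derivative f (at p within disc) = D"
    using assms by (meson has_derivative_within_disc_unique)
  then show "du f p = D (1, 0)" "dv f p = D (0, 1)"
    by (simp_all add: du_def dv_def)
qed

lemma has_derivative_du_dv:
  assumes "f differentiable (at p within disc)"
  shows "(f has_derivative (\<lambda>h. fst h *\<^sub>R du f p + snd h *\<^sub>R dv f p)) (at p within disc)"
proof -
  define D where "D = frechet_derivative f (at p within disc)"
  have D: "(f has_derivative D) (at p within disc)"
    using assms by (simp add: D_def frechet_derivative_works)
  interpret D: bounded_linear D using D by (rule has_derivative_bounded_linear)
  have "D = (\<lambda>h. fst h *\<^sub>R du f p + snd h *\<^sub>R dv f p)"
  proof
    fix h :: "real \<times> real"
    have "h = fst h *\<^sub>R (1, 0) + snd h *\<^sub>R (0, 1)" by (simp add: prod_eq_iff)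
    then have "D h = fst h *\<^sub>R D (1, 0) + snd h *\<^sub>R D (0, 1)" by (metis D.add D.scaleR)
    then show "D h = fst h *\<^sub>R du f p + snd h *\<^sub>R dv f p"
      unfolding du_def dv_def D_def[symmetric] .
  qed
  with D show ?thesis by metis
qed

section \<open>Calculus of the classes \<open>C_disc\<close>\<close>

lemma has_derivative_cong_disc:
  assumes "p \<in> disc" "\<And>q. q \<in> disc \<Longrightarrow> f q = g q"
  shows "(f has_derivative D) (at p within disc) \<longleftrightarrow> (g has_derivative D) (at p within disc)"
  using has_derivative_transform[of p disc f g D] has_derivative_transform[of p disc g f D] assms
  by metis

text \<open>Formulas for \<open>du f\<close> and \<open>dv f\<close> are available only at points of
  the disc, so the class has to ignore values elsewhere.\<close>

lemma C_disc_cong: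
  assumes "\<And>p. p \<in> disc \<Longrightarrow> f p = g p"
  shows "C_disc k f \<longleftrightarrow> C_disc k g"
  using assms
proof (induction k arbitrary: f g)
  case 0
  then show ?case by (auto intro!: continuous_on_cong)
next
  case (Suc k)
  have d: "(f has_derivative D) (at p within disc) \<longleftrightarrow> (g has_derivative D) (at p within disc)"
    if "p \<in> disc" for p D
    using Suc.prems that by (intro has_derivative_cong_disc)
  then have "f differentiable_on disc \<longleftrightarrow> g differentiable_on disc"
    by (auto simp: differentiable_on_def differentiable_def)
  moreover have "du f p = du g p" "dv f p = dv g p" if "p \<in> disc" for p
    by (simp_all add: du_def dv_def frechet_derivative_def d[OF that])
  ultimately show ?case
    using Suc.IH[of "du f" "du g"] Suc.IH[of "dv f" "dv g"] by simp
qed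

text \<open>The closure properties below exhibit partial derivatives \<open>f1\<close> and
  \<open>f2\<close> and pass through this rule, instead of evaluating \<open>du\<close> and
  \<open>dv\<close>.\<close>

lemma C_disc_SucI:
  assumes "\<And>p. p \<in> disc \<Longrightarrow>
      (f has_derivative (\<lambda>h. fst h *\<^sub>R f1 p + snd h *\<^sub>R f2 p)) (at p within disc)"
    and "C_disc k f1" "C_disc k f2"
  shows "C_disc (Suc k) f"
proof -
  have "du f p = f1 p" "dv f p = f2 p" if "p \<in> disc" for p
    using du_dv_eqI[OF assms(1)[OF that] that] by simp_all
  then have "C_disc k (du f)" "C_disc k (dv f)"
    using assms(2,3) C_disc_cong by blast+
  moreover have "f differentiable_on disc"
    using assms(1) by (auto simp: differentiable_on_def differentiable_def)
  ultimately show ?thesis by simp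
qed

lemma C_disc_Suc_has_derivative:
  assumes "C_disc (Suc k) f" "p \<in> disc"
  shows "(f has_derivative (\<lambda>h. fst h *\<^sub>R du f p + snd h *\<^sub>R dv f p)) (at p within disc)"
  using assms by (auto intro!: has_derivative_du_dv simp: differentiable_on_def)

lemma C_disc_SucD: "C_disc (Suc k) f \<Longrightarrow> C_disc k f"
proof (induction k arbitrary: f)
  case 0
  then show ?case by (auto simp: differentiable_imp_continuous_on)
next
  case (Suc k)
  from Suc.IH[of "du f"] Suc.IH[of "dv f"] Suc.prems show ?case by simp
qed

lemma C_disc_imp_continuous_on: "C_disc k f \<Longrightarrow> continuous_on disc f"
  by (cases k) (auto simp: differentiable_imp_continuous_on)

lemma C_disc_Suc_continuous_on:
  assumes "C_disc (Suc k) f"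
  shows "continuous_on disc f" "continuous_on disc (du f)" "continuous_on disc (dv f)"
  using assms C_disc_imp_continuous_on by (blast, simp_all, blast+)

lemma C_disc_const [intro]: "C_disc k (\<lambda>_. c)"
proof (induction k arbitrary: c)
  case (Suc k)
  show ?case by (rule C_disc_SucI[OF _ Suc Suc, of _ 0 0]) simp
qed simp

lemma C_disc_fst [intro]: "C_disc k fst"
proof (cases k)
  case (Suc j)
  show ?thesis unfolding Suc
    by (rule C_disc_SucI[of _ "\<lambda>_. 1" "\<lambda>_. 0"])
      (auto intro!: bounded_linear_imp_has_derivative bounded_linear_fst)
qed (auto intro: continuous_intros)

lemma C_disc_snd [intro]: "C_disc k snd"
proof (cases k)
  case (Suc j)
  show ?thesis unfolding Suc
    by (rule C_disc_SucI[of _ "\<lambda>_. 0" "\<lambda>_. 1"])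
      (auto intro!: bounded_linear_imp_has_derivative bounded_linear_snd)
qed (auto intro: continuous_intros)

lemma C_disc_add:
  assumes "C_disc k f" "C_disc k g"
  shows "C_disc k (\<lambda>p. f p + g p)"
  using assms
proof (induction k arbitrary: f g)
  case 0
  then show ?case by (auto intro: continuous_intros)
next
  case (Suc k)
  show ?case
  proof (rule C_disc_SucI)
    fix p assume "p \<in> disc"
    from has_derivative_add[OF Suc.prems[THEN C_disc_Suc_has_derivative, OF this]]
    show "((\<lambda>p. f p + g p) has_derivative
        (\<lambda>h. fst h *\<^sub>R (du f p + du g p) + snd h *\<^sub>R (dv f p + dv g p))) (at p within disc)"
      by (simp add: algebra_simps)
  qed (use Suc in auto)
qed

text \<open>The Leibniz rule pairs each factor with a derivative of the other, so the induction also
  uses both factors one order lower. On the reals this is the ordinary product.\<close>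

lemma C_disc_inner:
  assumes "C_disc k f" "C_disc k g"
  shows "C_disc k (\<lambda>p. f p \<bullet> g p)"
  using assms
proof (induction k arbitrary: f g)
  case 0
  then show ?case by (auto intro: continuous_intros)
next
  case (Suc k)
  show ?case
  proof (rule C_disc_SucI)
    fix p assume "p \<in> disc"
    from has_derivative_inner[OF Suc.prems[THEN C_disc_Suc_has_derivative, OF this]]
    show "((\<lambda>p. f p \<bullet> g p) has_derivative
        (\<lambda>h. fst h *\<^sub>R (f p \<bullet> du g p + du f p \<bullet> g p)
           + snd h *\<^sub>R (f p \<bullet> dv g p + dv f p \<bullet> g p))) (at p within disc)"
      by (simp add: algebra_simps inner_add_left inner_add_right)
  qed (use Suc C_disc_SucD in \<open>auto intro!: C_disc_add\<close>)
qed

lemma C_disc_mult: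
  fixes f g :: "real \<times> real \<Rightarrow> real"
  shows "C_disc k f \<Longrightarrow> C_disc k g \<Longrightarrow> C_disc k (\<lambda>p. f p * g p)"
  using C_disc_inner[of k f g] by simp

lemma C_disc_diff_const:
  fixes f :: "real \<times> real \<Rightarrow> real"
  shows "C_disc k f \<Longrightarrow> C_disc k (\<lambda>p. f p - c)"
  using C_disc_add[of k f "\<lambda>_. - c"] by auto

section \<open>Powers of the positive part\<close>

lemma has_real_derivative_pos_part_power:
  "((\<lambda>x. max 0 x ^ Suc (Suc n)) has_real_derivative real (Suc (Suc n)) * max 0 x ^ Suc n) (at x)"
proof (cases x "0 :: real" rule: linorder_cases)
  case less
  have "((\<lambda>x. 0 :: real) has_real_derivative real (Suc (Suc n)) * max 0 x ^ Suc n) (at x)"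
    using less by simp
  then show ?thesis
    by (rule DERIV_cong_ev[THEN iffD1, rotated -1])
      (use less in \<open>auto intro!: eventually_mono[OF eventually_nhds_in_open[of "{..<0}"]]\<close>)
next
  case greater
  have "((\<lambda>x. x ^ Suc (Suc n)) has_real_derivative real (Suc (Suc n)) * max 0 x ^ Suc n) (at x)"
    using greater DERIV_pow[of "Suc (Suc n)" x] by simp
  then show ?thesis
    by (rule DERIV_cong_ev[THEN iffD1, rotated -1])
      (use greater in \<open>auto intro!: eventually_mono[OF eventually_nhds_in_open[of "{0<..}"]]\<close>)
next
  case equal
  \<comment> \<open>This is the difference quotient at 0. Its factor \<open>max 0 h / h\<close> is 0
    or 1, and the remaining power still has exponent at least 1, so it forces the limit 0.\<close>
  have "((\<lambda>h::real. max 0 h ^ Suc n * (max 0 h / h)) \<longlongrightarrow> 0) (at 0)"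
  proof (rule Lim_null_comparison)
    show "\<forall>\<^sub>F h in at (0::real). norm (max 0 h ^ Suc n * (max 0 h / h)) \<le> max 0 h ^ Suc n"
      by (intro always_eventually) (auto simp: max_def)
    show "((\<lambda>h::real. max 0 h ^ Suc n) \<longlongrightarrow> 0) (at 0)"
      by (auto intro!: tendsto_eq_intros)
  qed
  then show ?thesis
    using equal by (simp add: DERIV_def algebra_simps)
qed

lemma has_derivative_pos_part_power:
  assumes "(f has_derivative (\<lambda>h. fst h *\<^sub>R f1 + snd h *\<^sub>R f2)) (at p within disc)"
  shows "((\<lambda>p. max 0 (f p) ^ Suc (Suc n)) has_derivative
     (\<lambda>h. fst h *\<^sub>R (real (Suc (Suc n)) * max 0 (f p) ^ Suc n * f1)
        + snd h *\<^sub>R (real (Suc (Suc n)) * max 0 (f p) ^ Suc n * f2))) (at p within disc)"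
  using has_derivative_compose[OF assms
      has_real_derivative_pos_part_power[unfolded has_field_derivative_def, of n "f p"]]
  by (simp add: algebra_simps)

text \<open>Each derivative lowers the exponent by one, and exponent 1 is still continuous. Hence
  the fourth powers used as C^3 test functions.\<close>

lemma C_disc_pos_part_power:
  fixes f :: "real \<times> real \<Rightarrow> real"
  assumes "C_disc k f"
  shows "C_disc k (\<lambda>p. max 0 (f p) ^ Suc k)"
  using assms
proof (induction k arbitrary: f)
  case 0
  then show ?case by (auto intro!: continuous_intros)
next
  case (Suc k)
  have *: "C_disc k (\<lambda>p. real (Suc (Suc k)) * max 0 (f p) ^ Suc k)"
    by (intro C_disc_mult C_disc_const Suc.IH C_disc_SucD[OF Suc.prems])
  show ?case
    by (rule C_disc_SucI, rule has_derivative_pos_part_power,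
        erule C_disc_Suc_has_derivative[OF Suc.prems])
      (use Suc.prems * in \<open>auto intro!: C_disc_mult\<close>)
qed

section \<open>The weak form of the Euler-Lagrange equation\<close>

text \<open>Differentiating the orthonormality relations makes the matrix of the products
  \<open>D1 h\<close>, \<open>D2 h\<close> against \<open>N1 p\<close>, \<open>N2 p\<close> skew.
  Plane rotations commute, so its single entry is unchanged by the rotation except for the
  derivative of the angle \<open>t * \<phi>\<close>.\<close>

lemma rotated_torsion:
  fixes N1 N2 :: "real \<times> real \<Rightarrow> real^4" and \<phi> :: "real \<times> real \<Rightarrow> real" and t :: real
  assumes N1: "(N1 has_derivative D1) (at p within disc)"
    and N2: "(N2 has_derivative D2) (at p within disc)"
    and \<phi>: "(\<phi> has_derivative D) (at p within disc)"
    and p: "p \<in> disc"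
    and on: "\<And>q. q \<in> disc \<Longrightarrow> N1 q \<bullet> N1 q = 1" "\<And>q. q \<in> disc \<Longrightarrow> N2 q \<bullet> N2 q = 1"
      "\<And>q. q \<in> disc \<Longrightarrow> N1 q \<bullet> N2 q = 0"
  defines "M1 \<equiv> \<lambda>p. cos (t * \<phi> p) *\<^sub>R N1 p + sin (t * \<phi> p) *\<^sub>R N2 p"
    and "M2 \<equiv> \<lambda>p. - sin (t * \<phi> p) *\<^sub>R N1 p + cos (t * \<phi> p) *\<^sub>R N2 p"
  shows "torsion_u M1 M2 p = torsion_u N1 N2 p + t * du \<phi> p"
    and "torsion_v M1 M2 p = torsion_v N1 N2 p + t * dv \<phi> p"
proof -
  let ?c = "cos (t * \<phi> p)" and ?s = "sin (t * \<phi> p)"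
  \<comment> \<open>The relations hold only on the disc; uniqueness of the derivative within it
    still makes their derivatives vanish, boundary included.\<close>
  have const: "F = (\<lambda>_. 0)"
    if "(f has_derivative F) (at p within disc)" "\<And>q. q \<in> disc \<Longrightarrow> f q = c" for f F and c :: real
  proof -
    have "((\<lambda>_. c) has_derivative F) (at p within disc)"
      using that has_derivative_cong_disc[OF p, of f "\<lambda>_. c"] by blast
    then show ?thesis
      by (rule has_derivative_within_disc_unique[OF _ has_derivative_const p])
  qed
  have 1: "D1 h \<bullet> N1 p = 0" for h
    using fun_cong[OF const[OF has_derivative_inner[OF N1 N1] on(1)], of h]
    by (simp add: inner_commute)
  have 2: "D2 h \<bullet> N2 p = 0" for h
    using fun_cong[OF const[OF has_derivative_inner[OF N2 N2] on(2)], of h]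
    by (simp add: inner_commute)
  have 3: "D2 h \<bullet> N1 p = - (D1 h \<bullet> N2 p)" for h
    using fun_cong[OF const[OF has_derivative_inner[OF N1 N2] on(3)], of h]
    by (simp add: inner_commute)
  have M1: "(M1 has_derivative (\<lambda>h. ?c *\<^sub>R D1 h - (?s * (t * D h)) *\<^sub>R N1 p
      + (?s *\<^sub>R D2 h + (?c * (t * D h)) *\<^sub>R N2 p))) (at p within disc)"
    unfolding M1_def
    by (rule derivative_eq_intros N1 N2 \<phi> refl)+ (auto simp: algebra_simps)
  have main: "(?c *\<^sub>R D1 h - (?s * (t * D h)) *\<^sub>R N1 p + (?s *\<^sub>R D2 h + (?c * (t * D h)) *\<^sub>R N2 p))
      \<bullet> M2 p = D1 h \<bullet> N2 p + t * D h" (is "?L = ?R") for h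
  proof -
    have "?L = - ?c * ?s * (D1 h \<bullet> N1 p) + ?c * ?c * (D1 h \<bullet> N2 p)
        + ?s * ?s * (t * D h) * (N1 p \<bullet> N1 p) - ?s * ?c * (t * D h) * (N1 p \<bullet> N2 p)
        - ?s * ?s * (D2 h \<bullet> N1 p) + ?s * ?c * (D2 h \<bullet> N2 p)
        - ?c * ?s * (t * D h) * (N1 p \<bullet> N2 p) + ?c * ?c * (t * D h) * (N2 p \<bullet> N2 p)"
      unfolding M2_def
      by (simp add: inner_add_left inner_add_right inner_diff_left
          inner_commute[of "N2 p" "N1 p"] algebra_simps)
    also have "\<dots> = (?c\<^sup>2 + ?s\<^sup>2) * (D1 h \<bullet> N2 p + t * D h)"
      unfolding 1 2 3 on(1)[OF p] on(2)[OF p] on(3)[OF p]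
      by algebra
    finally have "?L = (?c\<^sup>2 + ?s\<^sup>2) * (D1 h \<bullet> N2 p + t * D h)" .
    then show ?thesis by simp
  qed
  show "torsion_u M1 M2 p = torsion_u N1 N2 p + t * du \<phi> p"
    using main[of "(1, 0)"] du_dv_eqI[OF M1 p] du_dv_eqI[OF N1 p] du_dv_eqI[OF \<phi> p]
    by (simp add: torsion_u_def)
  show "torsion_v M1 M2 p = torsion_v N1 N2 p + t * dv \<phi> p"
    using main[of "(0, 1)"] du_dv_eqI[OF M1 p] du_dv_eqI[OF N1 p] du_dv_eqI[OF \<phi> p]
    by (simp add: torsion_v_def)
qed

lemma set_integrable_disc:
  fixes f :: "real \<times> real \<Rightarrow> real"
  assumes "continuous_on disc f"
  shows "set_integrable lborel disc f"
  unfolding set_integrable_def using assms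
  by (intro borel_integrable_compact) (auto simp: disc_eq_cball)

lemma critical_weak_form:
  assumes sec: "orthonormal_normal_section X N1 N2"
    and crit: "critical_for_total_torsion N1 N2"
    and \<phi>: "C_disc 3 \<phi>"
  shows "(LINT p:disc|lborel. torsion_u N1 N2 p * du \<phi> p + torsion_v N1 N2 p * dv \<phi> p) = 0"
proof -
  let ?a = "torsion_u N1 N2" and ?b = "torsion_v N1 N2"
  have C: "C_disc (Suc 2) N1" "C_disc (Suc 2) N2" "C_disc (Suc 2) \<phi>"
    using sec \<phi> by (simp_all add: orthonormal_normal_section_def numeral_eq_Suc)
  then have cont: "continuous_on disc ?a" "continuous_on disc ?b"
    "continuous_on disc (du \<phi>)" "continuous_on disc (dv \<phi>)"
    unfolding torsion_u_def torsion_v_def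
    by (blast intro: continuous_on_inner C_disc_Suc_continuous_on)+
  have on: "N1 q \<bullet> N1 q = 1" "N2 q \<bullet> N2 q = 1" "N1 q \<bullet> N2 q = 0" if "q \<in> disc" for q
    using sec that unfolding orthonormal_normal_section_def norm_eq_1 by blast+
  \<comment> \<open>Coefficients of the quadratic polynomial in \<open>t\<close>, up to constant
    factors: \<open>A\<close> from the torsion field alone, \<open>B\<close> from its product with
    the gradient of \<phi>, \<open>K\<close> from the squared gradient. The derivative at 0 is
    \<open>4 * B\<close>.\<close>
  define A where "A = (LINT p:disc|lborel. (?a p)\<^sup>2 + (?b p)\<^sup>2)"
  define B where "B = (LINT p:disc|lborel. ?a p * du \<phi> p + ?b p * dv \<phi> p)"
  define K where "K = (LINT p:disc|lborel. (du \<phi> p)\<^sup>2 + (dv \<phi> p)\<^sup>2)"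
  have tt: "total_torsion
                (\<lambda>p. cos (t * \<phi> p) *\<^sub>R N1 p + sin (t * \<phi> p) *\<^sub>R N2 p)
                (\<lambda>p. - sin (t * \<phi> p) *\<^sub>R N1 p + cos (t * \<phi> p) *\<^sub>R N2 p)
            = 2 * (A + (2 * t) * B + t\<^sup>2 * K)" for t
  proof -
    have "total_torsion
                (\<lambda>p. cos (t * \<phi> p) *\<^sub>R N1 p + sin (t * \<phi> p) *\<^sub>R N2 p)
                (\<lambda>p. - sin (t * \<phi> p) *\<^sub>R N1 p + cos (t * \<phi> p) *\<^sub>R N2 p)
       = 2 * (LINT p:disc|lborel. (?a p + t * du \<phi> p)\<^sup>2 + (?b p + t * dv \<phi> p)\<^sup>2)"
      unfolding total_torsion_def
    proof (intro arg_cong[where f = "(*) 2"] set_lebesgue_integral_cong allI impI)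
      fix p assume p: "p \<in> disc"
      note R = rotated_torsion[OF C[THEN C_disc_Suc_has_derivative, OF p] p on]
      show "(torsion_u (\<lambda>p. cos (t * \<phi> p) *\<^sub>R N1 p + sin (t * \<phi> p) *\<^sub>R N2 p)
              (\<lambda>p. - sin (t * \<phi> p) *\<^sub>R N1 p + cos (t * \<phi> p) *\<^sub>R N2 p) p)\<^sup>2 +
            (torsion_v (\<lambda>p. cos (t * \<phi> p) *\<^sub>R N1 p + sin (t * \<phi> p) *\<^sub>R N2 p)
              (\<lambda>p. - sin (t * \<phi> p) *\<^sub>R N1 p + cos (t * \<phi> p) *\<^sub>R N2 p) p)\<^sup>2 =
            (?a p + t * du \<phi> p)\<^sup>2 + (?b p + t * dv \<phi> p)\<^sup>2"
        by (simp only: R)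
    qed (simp add: disc_eq_cball)
    also have "(LINT p:disc|lborel. (?a p + t * du \<phi> p)\<^sup>2 + (?b p + t * dv \<phi> p)\<^sup>2)
       = (LINT p:disc|lborel. ((?a p)\<^sup>2 + (?b p)\<^sup>2) + (2 * t) * (?a p * du \<phi> p + ?b p * dv \<phi> p)
             + t\<^sup>2 * ((du \<phi> p)\<^sup>2 + (dv \<phi> p)\<^sup>2))"
      by (simp add: power2_eq_square algebra_simps)
    also have "\<dots> = A + (2 * t) * B + t\<^sup>2 * K"
      unfolding A_def B_def K_def
      by (simp add: set_integral_add(2) set_integrable_disc continuous_intros cont)
    finally show ?thesis .
  qed
  have "((\<lambda>t. 2 * (A + (2 * t) * B + t\<^sup>2 * K)) has_real_derivative 0) (at 0)"
    using crit[unfolded critical_for_total_torsion_def, rule_format, OF \<phi>] by (simp only: tt)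
  moreover have "((\<lambda>t. 2 * (A + (2 * t) * B + t\<^sup>2 * K)) has_real_derivative 4 * B) (at 0)"
    by (auto intro!: derivative_eq_intros)
  ultimately have "4 * B = 0" using DERIV_unique by blast
  then show ?thesis by (simp add: B_def)
qed

section \<open>From the weak form to the pointwise equations\<close>

text \<open>A nonnegative integrand with zero integral vanishes almost everywhere, whereas a
  nonempty open set is not negligible. Both test function arguments reach their contradiction
  here.\<close>

lemma integral_pos_on_open_imp_empty:
  fixes g :: "'a::euclidean_space \<Rightarrow> real"
  assumes "integrable lborel g" "(LINT x|lborel. g x) = 0" "\<And>x. 0 \<le> g x"
    and "open S" "\<And>x. x \<in> S \<Longrightarrow> 0 < g x"
  shows "S = {}"
proof -
  have "AE x in lborel. g x = 0"
    using integral_nonneg_eq_0_iff_AE[of lborel g] assms(1,2,3) by simp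
  then have "AE x in lborel. x \<notin> S"
    by eventually_elim (use assms(5) in force)
  then have "S \<in> null_sets lborel"
    using AE_iff_null_sets[of S lborel] assms(4) by simp
  then have "negligible S"
    by (simp add: negligible_iff_null_sets null_sets_completionI)
  then show ?thesis using open_not_negligible assms(4) by blast
qed

text \<open>The weak equation is invariant under \<open>(a, b)\<close> going to
  \<open>(-a, -b)\<close>, so a one-sided bound suffices: applied to both fields it gives
  equality.\<close>

lemma weak_solution_no_outflow:
  fixes a b :: "real \<times> real \<Rightarrow> real"
  assumes cont: "continuous_on disc a" "continuous_on disc b"
    and weak: "\<And>\<phi>. C_disc 3 \<phi> \<Longrightarrow> (LINT q:disc|lborel. a q * du \<phi> q + b q * dv \<phi> q) = 0"
    and p: "p \<in> circle"
  shows "a p * fst p + b p * snd p \<le> 0"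
proof (rule ccontr)
  assume neg: "\<not> a p * fst p + b p * snd p \<le> 0"
  \<comment> \<open>The component of the field in the fixed direction \<open>p\<close>, not in the
    varying radial direction: the gradient of the test function is parallel to \<open>p\<close>
    everywhere.\<close>
  define f where "f q = a q * fst p + b q * snd p" for q
  have pp: "p \<bullet> p = 1" "p \<in> disc"
    using p by (auto simp: circle_def disc_def power2_eq_square)
  have "continuous_on disc f"
    unfolding f_def by (intro continuous_intros cont)
  moreover have "f p > 0" using neg by (simp add: f_def)
  ultimately obtain d where d: "d > 0" "\<And>q. q \<in> disc \<Longrightarrow> dist q p < d \<Longrightarrow> f q > 0"
  proof -
    assume cont_f: "continuous_on disc f" and fp: "f p > 0"
    then obtain d where d: "d > 0" "\<And>q. q \<in> disc \<Longrightarrow> dist q p < d \<Longrightarrow> dist (f q) (f p) < f p"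
      unfolding continuous_on_iff using pp(2) by blast
    have "f q > 0" if "q \<in> disc" "dist q p < d" for q
      using d(2)[OF that] by (simp add: dist_real_def abs_less_iff)
    with d(1) show thesis by (rule that)
  qed
  \<comment> \<open>For \<open>q\<close> in the disc, |q - p|^2 <= 2 - 2 (q . p). The threshold is
    chosen so that \<open>l q > 0\<close> puts \<open>q\<close> within distance \<open>d\<close> of
    \<open>p\<close>.\<close>
  define l where "l q = q \<bullet> p - (1 - d\<^sup>2 / 2)" for q
  have near: "f q > 0" if "q \<in> disc" "l q > 0" for q
  proof -
    have "norm q \<le> 1" using that by (simp add: disc_eq_cball)
    then have "q \<bullet> q \<le> 1" by (simp add: dot_square_norm power_le_one)
    then have "(dist q p)\<^sup>2 < d\<^sup>2"
      using that(2) pp(1)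
      by (simp add: l_def dist_norm power2_norm_eq_inner inner_diff_left inner_diff_right inner_commute)
    then have "dist q p < d" using d(1) by (simp add: power_less_imp_less_base)
    then show ?thesis using d that by blast
  qed
  have dl: "(l has_derivative (\<lambda>h. fst h *\<^sub>R fst p + snd h *\<^sub>R snd p)) (at q within disc)" for q
    unfolding l_def by (auto intro!: derivative_eq_intros simp: inner_prod_def)
  have Cl: "C_disc k l" for k
    unfolding l_def[abs_def] inner_prod_def inner_real_def
    by (intro C_disc_diff_const C_disc_add C_disc_mult C_disc_fst C_disc_snd C_disc_const)
  define \<phi> where "\<phi> q = max 0 (l q) ^ Suc 3" for q
  have \<phi>: "C_disc 3 \<phi>"
    unfolding \<phi>_def by (rule C_disc_pos_part_power[OF Cl])
  define g where "g q = indicator disc q *\<^sub>R (a q * du \<phi> q + b q * dv \<phi> q)" for q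
  have d\<phi>: "du \<phi> q = 4 * max 0 (l q) ^ 3 * fst p" "dv \<phi> q = 4 * max 0 (l q) ^ 3 * snd p" if "q \<in> disc" for q
    using du_dv_eqI[OF has_derivative_pos_part_power[OF dl, of 2] that]
    by (simp_all add: \<phi>_def[abs_def])
  have g: "g q = 4 * max 0 (l q) ^ 3 * f q" if "q \<in> disc" for q
    using that by (simp add: g_def d\<phi> f_def algebra_simps)
  have "C_disc (Suc 2) \<phi>" using \<phi> by (simp add: numeral_eq_Suc)
  then have "integrable lborel g"
    unfolding g_def
    by (intro set_integrable_disc[unfolded set_integrable_def] continuous_intros cont)
      (blast intro: C_disc_Suc_continuous_on)+
  moreover have "(LINT q|lborel. g q) = 0"
    using weak[OF \<phi>] by (simp add: g_def set_lebesgue_integral_def)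
  moreover have "0 \<le> g q" for q
  proof (cases "q \<in> disc \<and> l q > 0")
    case True
    then show ?thesis using near[of q] by (simp add: g)
  next
    case False
    then show ?thesis by (cases "q \<in> disc") (auto simp: g, simp add: g_def)
  qed
  \<comment> \<open>The disc is not open, so positivity is tested on the part of the cap inside the
    open ball.\<close>
  moreover have "open (ball 0 1 \<inter> {q. 0 < l q})"
    unfolding l_def by (intro open_Int open_ball open_Collect_less continuous_intros)
  moreover have "0 < g q" if "q \<in> ball 0 1 \<inter> {q. 0 < l q}" for q
    using that near[of q] by (simp add: g disc_eq_cball)
  ultimately have "ball 0 1 \<inter> {q. 0 < l q} = {}"
    by (rule integral_pos_on_open_imp_empty)
  \<comment> \<open>At \<open>(1 - e) *\<^sub>R p\<close> the value of \<open>l\<close> is d^2/2 -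
    e. The bound 1/2 keeps the point in the open ball, the bound d^2/4 keeps \<open>l\<close>
    positive.\<close>
  moreover define e where "e = min (1/2) (d\<^sup>2 / 4)"
  have "0 < e" "e < 1" "e < d\<^sup>2 / 2" using d(1) by (auto simp: e_def min_def)
  then have "(1 - e) *\<^sub>R p \<in> ball 0 1 \<inter> {q. 0 < l q}"
    using pp(1) by (simp add: l_def norm_eq_sqrt_inner)
  ultimately show False by blast
qed

section \<open>Quarter turns and translations of Lebesgue measure\<close>

lemma lborel_distr_quarter_turn:
  "distr lborel borel (\<lambda>q. (- snd q, fst q)) = (lborel :: (real \<times> real) measure)"
proof -
  let ?L = "lborel :: real measure"
  have id: "distr ?L borel (\<lambda>x. x) = ?L" by (simp add: distr_id2)
  \<comment> \<open>The quarter turn is the coordinate swap followed by the reflection of the first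
    coordinate; both preserve the product measure.\<close>
  have "distr ?L borel uminus \<Otimes>\<^sub>M distr ?L borel (\<lambda>x. x)
      = distr (?L \<Otimes>\<^sub>M ?L) (borel \<Otimes>\<^sub>M borel) (\<lambda>(x, y). (- x, y))"
    by (rule pair_measure_distr) (simp_all add: id lborel.sigma_finite_measure_axioms)
  then have neg: "distr (?L \<Otimes>\<^sub>M ?L) (borel \<Otimes>\<^sub>M borel) (\<lambda>(x, y). (- x, y)) = ?L \<Otimes>\<^sub>M ?L"
    by (simp only: lborel_distr_uminus id)
  have "?L \<Otimes>\<^sub>M ?L = distr (distr (?L \<Otimes>\<^sub>M ?L) (?L \<Otimes>\<^sub>M ?L) (\<lambda>(x, y). (y, x)))
      (borel \<Otimes>\<^sub>M borel) (\<lambda>(x, y). (- x, y))"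
    by (simp only: lborel_pair.distr_pair_swap[symmetric] neg)
  also have "\<dots> = distr (?L \<Otimes>\<^sub>M ?L) (borel \<Otimes>\<^sub>M borel) ((\<lambda>(x, y). (- x, y)) \<circ> (\<lambda>(x, y). (y, x)))"
    by (intro distr_distr) (auto simp: measurable_pair_swap')
  finally show ?thesis
    unfolding lborel_prod borel_prod o_def case_prod_unfold fst_conv snd_conv by (rule sym)
qed

lemma lborel_integral_quarter_turn:
  fixes f :: "real \<times> real \<Rightarrow> real"
  assumes "integrable lborel f"
  shows "integrable lborel (\<lambda>q. f (- snd q, fst q))"
    and "(LINT q|lborel. f (- snd q, fst q)) = (LINT q|lborel. f q)"
proof -
  have m: "(\<lambda>q. (- snd q, fst q)) \<in> measurable lborel (borel :: (real \<times> real) measure)"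
    by (simp add: borel_prod[symmetric])
  have f: "f \<in> borel_measurable borel"
    using assms by auto
  show "integrable lborel (\<lambda>q. f (- snd q, fst q))"
    using integrable_distr_eq[OF m f] assms by (simp add: lborel_distr_quarter_turn)
  show "(LINT q|lborel. f (- snd q, fst q)) = (LINT q|lborel. f q)"
    using integral_distr[OF m f] by (simp add: lborel_distr_quarter_turn)
qed

lemma lborel_integral_translation:
  fixes f :: "'a::euclidean_space \<Rightarrow> real"
  assumes "integrable lborel f"
  shows "integrable lborel (\<lambda>q. f (c + q))"
    and "(LINT q|lborel. f (c + q)) = (LINT q|lborel. f q)"
proof -
  have m: "(+) c \<in> measurable lborel borel" by simp
  have f: "f \<in> borel_measurable borel" using assms by auto
  show "integrable lborel (\<lambda>q. f (c + q))"
    using integrable_distr_eq[OF m f] assms by (simp add: lborel_distr_plus)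
  show "(LINT q|lborel. f (c + q)) = (LINT q|lborel. f q)"
    using integral_distr[OF m f] by (simp add: lborel_distr_plus)
qed

text \<open>In the sum over the four turns of \<open>q\<close>, the constant terms cancel between
  opposite points and the terms with \<open>a2\<close> and \<open>b1\<close> cancel between
  perpendicular ones. What remains is 2 (a1 + b2) |q|^2 plus the Taylor errors.\<close>

lemma sum_quarter_turns_pos:
  fixes a b :: "real \<times> real \<Rightarrow> real"
  assumes a: "\<And>q. norm q < d \<Longrightarrow>
      \<bar>a (p + q) - a p - (fst q * a1 + snd q * a2)\<bar> \<le> (a1 + b2) / 8 * norm q"
    and b: "\<And>q. norm q < d \<Longrightarrow>
      \<bar>b (p + q) - b p - (fst q * b1 + snd q * b2)\<bar> \<le> (a1 + b2) / 8 * norm q"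
    and pos: "a1 + b2 > 0" and q: "norm q < d" "q \<noteq> 0"
  defines "S \<equiv> \<lambda>q. a (p + q) * fst q + b (p + q) * snd q"
  shows "S q + S (- snd q, fst q) + S (- fst q, - snd q) + S (snd q, - fst q) > 0"
proof -
  let ?n = "norm q" and ?D = "a1 + b2"
  define ea where "ea q = a (p + q) - a p - (fst q * a1 + snd q * a2)" for q
  define eb where "eb q = b (p + q) - b p - (fst q * b1 + snd q * b2)" for q
  define E where "E q = ea q * fst q + eb q * snd q" for q
  have S: "S q = E q + (a p + fst q * a1 + snd q * a2) * fst q
      + (b p + fst q * b1 + snd q * b2) * snd q" for q
    by (simp add: S_def E_def ea_def eb_def algebra_simps)
  have comp: "\<bar>fst q\<bar> \<le> norm q" "\<bar>snd q\<bar> \<le> norm q" for q :: "real \<times> real"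
    using norm_fst_le[of "fst q" "snd q"] norm_snd_le[of "snd q" "fst q"] by simp_all
  \<comment> \<open>Two products of size at most (a1 + b2)/8 |q|^2 make up each error. The four
    errors total at most half of the main term, which explains the constant 1/8.\<close>
  have E: "\<bar>E x\<bar> \<le> ?D / 4 * ?n\<^sup>2" if x: "norm x = ?n" for x
  proof -
    have e: "\<bar>ea x\<bar> \<le> ?D / 8 * ?n" "\<bar>eb x\<bar> \<le> ?D / 8 * ?n"
      using a[of x] b[of x] x q by (simp_all add: ea_def eb_def)
    have c: "\<bar>fst x\<bar> \<le> ?n" "\<bar>snd x\<bar> \<le> ?n" using comp[of x] x by simp_all
    have "\<bar>ea x * fst x\<bar> \<le> (?D / 8 * ?n) * ?n" "\<bar>eb x * snd x\<bar> \<le> (?D / 8 * ?n) * ?n"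
      unfolding abs_mult
      by (rule mult_mono[OF e(1) c(1)] mult_mono[OF e(2) c(2)]; use pos in simp)+
    then have "\<bar>E x\<bar> \<le> (?D / 8 * ?n) * ?n + (?D / 8 * ?n) * ?n"
      unfolding E_def by linarith
    then show ?thesis by (simp add: power2_eq_square algebra_simps)
  qed
  have n: "norm (- snd q, fst q) = ?n" "norm (- fst q, - snd q) = ?n" "norm (snd q, - fst q) = ?n"
    by (simp_all add: norm_prod_def add.commute)
  have nn: "?n\<^sup>2 = fst q * fst q + snd q * snd q"
    by (simp add: norm_prod_def power2_eq_square)
  have "S q + S (- snd q, fst q) + S (- fst q, - snd q) + S (snd q, - fst q)
    = E q + E (- snd q, fst q) + E (- fst q, - snd q) + E (snd q, - fst q) + 2 * ?D * ?n\<^sup>2"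
    unfolding S nn by (simp add: algebra_simps)
  moreover have "?D * ?n\<^sup>2 > 0" using pos q by simp
  ultimately show ?thesis
    using E[OF refl] E[OF n(1)] E[OF n(2)] E[OF n(3)] by linarith
qed

lemma weak_solution_no_source:
  fixes a b :: "real \<times> real \<Rightarrow> real"
  assumes cont: "continuous_on disc a" "continuous_on disc b"
    and weak: "\<And>\<phi>. C_disc 3 \<phi> \<Longrightarrow> (LINT q:disc|lborel. a q * du \<phi> q + b q * dv \<phi> q) = 0"
    and p: "p \<in> ball 0 1"
    and a: "(a has_derivative (\<lambda>h. fst h * a1 + snd h * a2)) (at p)"
    and b: "(b has_derivative (\<lambda>h. fst h * b1 + snd h * b2)) (at p)"
  shows "a1 + b2 \<le> 0"
proof (rule ccontr)
  assume "\<not> a1 + b2 \<le> 0"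
  then have D: "a1 + b2 > 0" by simp
  then have D8: "(a1 + b2) / 8 > 0" by simp
  obtain d1 where d1: "d1 > 0" "\<And>q. norm (q - p) < d1 \<Longrightarrow>
      norm (a q - a p - (fst (q - p) * a1 + snd (q - p) * a2)) \<le> (a1 + b2) / 8 * norm (q - p)"
    using a D8 unfolding has_derivative_at_alt by blast
  obtain d2 where d2: "d2 > 0" "\<And>q. norm (q - p) < d2 \<Longrightarrow>
      norm (b q - b p - (fst (q - p) * b1 + snd (q - p) * b2)) \<le> (a1 + b2) / 8 * norm (q - p)"
    using b D8 unfolding has_derivative_at_alt by blast
  \<comment> \<open>Within \<open>r\<close> of \<open>p\<close> both first-order estimates hold, and
    the last bound keeps these points in the disc.\<close>
  define r where "r = min (min d1 d2) (1 - norm p)"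
  have r: "r > 0" "r \<le> d1" "r \<le> d2" "r \<le> 1 - norm p"
    using d1 d2 p by (auto simp: r_def)
  define S where "S q = a (p + q) * fst q + b (p + q) * snd q" for q
  have S: "S q + S (- snd q, fst q) + S (- fst q, - snd q) + S (snd q, - fst q) > 0"
    if "norm q < r" "q \<noteq> 0" for q
    unfolding S_def using that r
    by (intro sum_quarter_turns_pos[where d = r and p = p and ?a1.0 = a1 and ?b2.0 = b2
          and ?a2.0 = a2 and ?b1.0 = b1] D)
      (use d1(2)[of "p + _"] d2(2)[of "p + _"] in auto)
  define l where "l q = r\<^sup>2 - (norm (q - p))\<^sup>2" for q
  \<comment> \<open>This polynomial form uses only sums, products and subtraction of constants,
    matching the closure rules for \<open>C_disc\<close>.\<close>
  have l_alt: "l q = (- 1) * ((fst q - fst p) * (fst q - fst p) + (snd q - snd p) * (snd q - snd p)) - (- r\<^sup>2)"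
    for q by (simp add: l_def norm_prod_def power2_eq_square)
  have dl: "(l has_derivative (\<lambda>h. fst h *\<^sub>R (- 2 * (fst q - fst p)) + snd h *\<^sub>R (- 2 * (snd q - snd p))))
      (at q within disc)" for q
    unfolding l_alt[abs_def] by (auto intro!: derivative_eq_intros simp: algebra_simps)
  have Cl: "C_disc k l" for k
    unfolding l_alt[abs_def]
    by (intro C_disc_diff_const C_disc_add C_disc_mult C_disc_fst C_disc_snd C_disc_const)
  define \<phi> where "\<phi> q = max 0 (l q) ^ Suc 3" for q
  have \<phi>: "C_disc 3 \<phi>"
    unfolding \<phi>_def by (rule C_disc_pos_part_power[OF Cl])
  define H where "H q = indicator disc q *\<^sub>R (a q * du \<phi> q + b q * dv \<phi> q)" for q
  \<comment> \<open>The integrand recentred at \<open>p\<close>. The bump decreases away from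
    \<open>p\<close>, so its gradient is a nonpositive multiple of \<open>q - p\<close>; the sign
    change compensates for this.\<close>
  define G where "G q = - H (p + q)" for q
  have d\<phi>: "du \<phi> q = 4 * max 0 (l q) ^ 3 * (- 2 * (fst q - fst p))" "dv \<phi> q = 4 * max 0 (l q) ^ 3 * (- 2 * (snd q - snd p))" if "q \<in> disc" for q
    using du_dv_eqI[OF has_derivative_pos_part_power[OF dl, of 2] that]
    by (simp_all add: \<phi>_def[abs_def])
  have H: "H q = - 8 * max 0 (l q) ^ 3 * S (q - p)" if "q \<in> disc" for q
    using that by (simp add: H_def d\<phi> S_def algebra_simps)
  have in_disc: "p + q \<in> disc" if "norm q < r" for q
    using norm_triangle_ineq[of p q] that r(4) by (simp add: disc_eq_cball)
  have G_in: "G q = 8 * (r\<^sup>2 - (norm q)\<^sup>2) ^ 3 * S q" if "norm q < r" for q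
  proof -
    have "(norm q)\<^sup>2 \<le> r\<^sup>2" using that by (intro power_mono) auto
    then show ?thesis using H[OF in_disc[OF that]] by (simp add: G_def l_def)
  qed
  have G_out: "G q = 0" if "\<not> norm q < r" for q
  proof -
    have "r\<^sup>2 \<le> (norm q)\<^sup>2" using that r by (intro power_mono) auto
    then show ?thesis
      using H[of "p + q"] by (cases "p + q \<in> disc") (simp_all add: G_def l_def, simp add: H_def)
  qed
  have "C_disc (Suc 2) \<phi>" using \<phi> by (simp add: numeral_eq_Suc)
  then have Hi: "integrable lborel H"
    unfolding H_def
    by (intro set_integrable_disc[unfolded set_integrable_def] continuous_intros cont)
      (blast intro: C_disc_Suc_continuous_on)+
  have H0: "(LINT q|lborel. H q) = 0"
    using weak[OF \<phi>] by (simp add: H_def set_lebesgue_integral_def)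
  have G0: "integrable lborel G" "(LINT q|lborel. G q) = 0"
    using lborel_integral_translation[OF Hi, of p] H0 by (simp_all add: G_def[abs_def])
  \<comment> \<open>Iterating the quarter turn yields the rotations by 90, 180 and 270 degrees, all
    with the same zero integral.\<close>
  note G1 = lborel_integral_quarter_turn[OF G0(1)]
  note G2 = lborel_integral_quarter_turn[OF G1(1), simplified]
  note G3 = lborel_integral_quarter_turn[OF G2(1), simplified]
  define K where "K q = G q + G (- snd q, fst q) + G (- fst q, - snd q) + G (snd q, - fst q)" for q
  have n: "norm (- snd q, fst q) = norm q" "norm (- fst q, - snd q) = norm q"
    "norm (snd q, - fst q) = norm q" for q :: "real \<times> real"
    by (simp_all add: norm_prod_def add.commute)
  \<comment> \<open>The weight depends only on \<open>norm q\<close>, so it is common to the four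
    turns and factors out of the sum.\<close>
  have K: "K q = 8 * (r\<^sup>2 - (norm q)\<^sup>2) ^ 3 *
      (S q + S (- snd q, fst q) + S (- fst q, - snd q) + S (snd q, - fst q))" if "norm q < r" for q
    unfolding K_def using that by (simp add: G_in n distrib_left)
  have Kpos: "K q > 0" if "norm q < r" "q \<noteq> 0" for q
  proof -
    have "(norm q)\<^sup>2 < r\<^sup>2" using that by (intro power_strict_mono) auto
    then show ?thesis unfolding K[OF that(1)] using S[OF that] by simp
  qed
  have "integrable lborel K"
    unfolding K_def using G0 G1 G2 G3 by simp
  moreover have "(LINT q|lborel. K q) = 0"
    unfolding K_def using G0 G1 G2 G3 by simp
  moreover have "0 \<le> K q" for q
  proof (cases "norm q < r")
    case True
    have "K 0 = 0" using r by (simp add: K S_def)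
    with True Kpos[of q] show ?thesis by (cases "q = 0") auto
  qed (simp add: K_def G_out n)
  \<comment> \<open>The centre is removed because \<open>K\<close> vanishes there.\<close>
  moreover have "open (ball 0 r - {0 :: real \<times> real})" by (intro open_Diff) auto
  moreover have "0 < K q" if "q \<in> ball 0 r - {0}" for q
    using that Kpos by simp
  ultimately have "ball 0 r - {0 :: real \<times> real} = {}"
    by (rule integral_pos_on_open_imp_empty)
  moreover have "(r / 2, 0) \<in> ball 0 r - {0 :: real \<times> real}"
    using r by (simp add: dist_Pair_Pair zero_prod_def)
  ultimately show False by blast
qed

section \<open>Application to the torsion field and its negative\<close>

theorem mainTheorem2:
  fixes X N1 N2 :: "real \<times> real \<Rightarrow> real^4"
  assumes "conformal_immersion X"
    and "orthonormal_normal_section X N1 N2"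
    and "critical_for_total_torsion N1 N2"
  shows "(\<forall>p\<in>disc. divergence (torsion_u N1 N2) (torsion_v N1 N2) p = 0) \<and>
         (\<forall>p\<in>circle. (torsion_u N1 N2 p, torsion_v N1 N2 p) \<bullet> outer_unit_normal p = 0)"
proof (intro conjI ballI)
  let ?a = "torsion_u N1 N2" and ?b = "torsion_v N1 N2"
  have N: "C_disc (Suc (Suc (Suc 0))) N1" "C_disc (Suc (Suc (Suc 0))) N2"
    using assms(2) by (simp_all add: orthonormal_normal_section_def numeral_eq_Suc)
  have "C_disc (Suc (Suc 0)) (du N1)" "C_disc (Suc (Suc 0)) (dv N1)"
    using N(1) by simp_all
  \<comment> \<open>One derivative of the C^3 section enters the torsion coefficients, so they are
    regular enough for a divergence continuous up to the boundary.\<close>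
  from this[THEN C_disc_SucD] N(2)[THEN C_disc_SucD, THEN C_disc_SucD]
  have C: "C_disc (Suc 0) ?a" "C_disc (Suc 0) ?b"
    unfolding torsion_u_def[abs_def] torsion_v_def[abs_def]
    by (blast intro: C_disc_inner)+
  then have cont: "continuous_on disc ?a" "continuous_on disc ?b"
    by (blast intro: C_disc_imp_continuous_on)+
  then have cont': "continuous_on disc (\<lambda>q. - ?a q)" "continuous_on disc (\<lambda>q. - ?b q)"
    by (auto intro: continuous_intros)
  have weak: "(LINT q:disc|lborel. ?a q * du \<phi> q + ?b q * dv \<phi> q) = 0" if "C_disc 3 \<phi>" for \<phi>
    using critical_weak_form[OF assms(2,3) that] .
  have weak': "(LINT q:disc|lborel. - ?a q * du \<phi> q + - ?b q * dv \<phi> q) = 0" if "C_disc 3 \<phi>" for \<phi>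
  proof -
    have "(LINT q:disc|lborel. - ?a q * du \<phi> q + - ?b q * dv \<phi> q)
        = (LINT q:disc|lborel. (- 1) * (?a q * du \<phi> q + ?b q * dv \<phi> q))" by simp
    also have "\<dots> = (- 1) * (LINT q:disc|lborel. ?a q * du \<phi> q + ?b q * dv \<phi> q)"
      by (rule set_integral_mult_right)
    finally show ?thesis using weak[OF that] by simp
  qed
  show "(?a p, ?b p) \<bullet> outer_unit_normal p = 0" if p: "p \<in> circle" for p
    using weak_solution_no_outflow[OF cont weak p] weak_solution_no_outflow[OF cont' weak' p]
    by (simp add: outer_unit_normal_def inner_prod_def)
  have interior: "divergence ?a ?b p = 0" if p: "p \<in> ball 0 1" for p
  proof -
    \<comment> \<open>At interior points the derivative within the disc is the ordinary one, so
      \<open>du\<close> and \<open>dv\<close> supply the coefficients for the source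
      estimate.\<close>
    have "at p within disc = at p" "p \<in> disc"
      using p by (auto simp: disc_eq_cball intro!: at_within_interior)
    then have a: "(?a has_derivative (\<lambda>h. fst h * du ?a p + snd h * dv ?a p)) (at p)"
      and b: "(?b has_derivative (\<lambda>h. fst h * du ?b p + snd h * dv ?b p)) (at p)"
      using C[THEN C_disc_Suc_has_derivative, of p] by simp_all
    have a': "((\<lambda>q. - ?a q) has_derivative (\<lambda>h. fst h * (- du ?a p) + snd h * (- dv ?a p))) (at p)"
      and b': "((\<lambda>q. - ?b q) has_derivative (\<lambda>h. fst h * (- du ?b p) + snd h * (- dv ?b p))) (at p)"
      using has_derivative_minus[OF a] has_derivative_minus[OF b] by simp_all
    show ?thesis
      using weak_solution_no_source[OF cont weak p a b]
        weak_solution_no_source[OF cont' weak' p a' b'] by (simp add: divergence_def)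
  qed
  \<comment> \<open>The source estimate needs a full neighbourhood of \<open>p\<close> in the disc;
    boundary points are reached by continuity from the dense interior.\<close>
  have "continuous_on disc (divergence ?a ?b)"
    unfolding divergence_def[abs_def] using C by (auto intro: continuous_intros)
  moreover have "disc = closure (ball 0 1)" by (simp add: disc_eq_cball)
  ultimately show "divergence ?a ?b p = 0" if "p \<in> disc" for p
    using continuous_constant_on_closure[of "ball 0 1" "divergence ?a ?b" 0 p] interior that by simp
qed

end
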